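(* Let $f$ be a transcendental meromorphic function on $\mathbb{C}$ and let $k$ be a positive integer. Let $b_1$ and $b_3$ be complex constants with $b_3\neq 0$. If $\left(b_3 f^3(z)+b_1 f(z)\right)^{(k)}$ is a periodic function, then $f$ is also a periodic function.
   Context: Meromorphic means meromorphic in the whole complex plane $\mathbb{C}$; transcendental means not a rational function. A meromorphic function $h$ is periodic if there is a constant $c\in\mathbb{C}\setminus\{0\}$ with $h(z+c)\equiv h(z)$. Here $f^3$ is the cube of $f$ (pointwise power) and $(\cdot)^{(k)}$ denotes the $k$-th derivative with respect to $z$. *)

theory Defs
  imports "HOL-Complex_Analysis.Complex_Analysis"
begin

text \<open>
  In the library, \<^prop>\<open>f meromorphic_on UNIV\<close> leaves the values of \<^term>\<open>f\<close> unconstrained on a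
  sparse set (a closed discrete set, in particular at the poles), and iterated derivatives take
  junk values there.  An identity \<open>g \<equiv> h\<close> between meromorphic functions is therefore read as
  agreement outside a sparse set, written \<open>\<forall>\<^sub>\<approx>z. g z = h z\<close>.
\<close>

definition rational_function :: "(complex \<Rightarrow> complex) \<Rightarrow> bool" where
  "rational_function f \<longleftrightarrow>
     (\<exists>p q :: complex poly. q \<noteq> 0 \<and> (\<forall>\<^sub>\<approx>z. f z = poly p z / poly q z))"

definition transcendental_meromorphic :: "(complex \<Rightarrow> complex) \<Rightarrow> bool" where
  "transcendental_meromorphic f \<longleftrightarrow> f meromorphic_on UNIV \<and> \<not> rational_function f"

definition periodic_meromorphic :: "(complex \<Rightarrow> complex) \<Rightarrow> bool" where
  "periodic_meromorphic h \<longleftrightarrow>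
     h meromorphic_on UNIV \<and> (\<exists>c. c \<noteq> 0 \<and> (\<forall>\<^sub>\<approx>z. h (z + c) = h z))"

text \<open>
  For a function normalised to be continuous off its poles and \<open>0\<close> at its poles, this is
  periodicity at every point.
\<close>

lemma periodic_meromorphic_iff_pointwise:
  assumes h: "h nicely_meromorphic_on UNIV"
  shows "periodic_meromorphic h \<longleftrightarrow> (\<exists>c. c \<noteq> 0 \<and> (\<forall>z. h (z + c) = h z))"
proof -
  have val: "remove_sings h = h"
  proof
    fix z
    have "(is_pole h z \<and> h z = 0) \<or> h \<midarrow>z\<rightarrow> h z"
      using h by (auto simp: nicely_meromorphic_on_def)
    thus "remove_sings h z = h z"
      by (metis remove_sings_at_pole remove_sings_eqI)
  qed
  have "h (z + c) = h z" if "\<forall>\<^sub>\<approx>z. h (z + c) = h z" for c z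
  proof -
    have ev: "eventually (\<lambda>w. h (w + c) = h w) (at z)"
      using that by (auto simp: eventually_cosparse_open_eq)
    have "h (z + c) = remove_sings (\<lambda>w. h (w + c)) z"
      using remove_sings_shift_0[of h "z + c"] remove_sings_shift_0[of "\<lambda>w. h (w + c)" z]
      by (simp only: val add_ac)
    also have "\<dots> = remove_sings h z"
      by (rule remove_sings_cong[OF ev refl])
    finally show ?thesis by (simp add: val)
  qed
  thus ?thesis
    using h by (auto simp: periodic_meromorphic_def nicely_meromorphic_on_def)
qed

end

theory Submission
  imports Defs "HOL-Computational_Algebra.Fundamental_Theorem_Algebra"
begin

text \<open>
  Write \<open>H x = b3 x\<^sup>3 + b1 x\<close> and let \<open>c\<close> be a period of the \<open>k\<close>-th derivative of \<open>F = H \<circ> f\<close>. The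
  difference \<open>F (z + c) - F z\<close> has vanishing \<open>k\<close>-th derivative, so it is a polynomial, and every
  polynomial has the form \<open>S (z + c) - S z\<close> for a polynomial \<open>S\<close>. Thus \<open>F = G + S\<close> with \<open>G\<close> periodic
  of period \<open>c\<close>.

  If \<open>S\<close> is constant, then \<open>F\<close> itself is periodic. The four functions \<open>f (z + j c)\<close>, \<open>j = 0, \<dots>, 3\<close>,
  are then roots of one cubic over the field of meromorphic functions, so two of them coincide
  and \<open>f\<close> is periodic (\<open>poly_value_repeats_imp_periodic\<close>).

  If \<open>S\<close> is not constant, then \<open>f\<close> is rational, contrary to the hypothesis. The translates
  \<open>f (z + n c)\<close> satisfy \<open>H (f (z + n c)) = G z + S (z + n c)\<close>, where \<open>S (z + n c)\<close> tends to infinity with \<open>n\<close>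
  locally uniformly in \<open>z\<close>. First, \<open>f\<close> has no poles (\<open>no_pole_if_shifts_differ_by_poly\<close>): near a pole, for large \<open>n\<close>,
  the translate must take as its value a critical point \<open>x\<close> of \<open>H\<close>, while the resulting
  equations \<open>G = H x - S\<close> and \<open>G' = - S'\<close> contradict the growth of \<open>G' / G\<close> at a pole of \<open>G\<close>.

  So \<open>f\<close> is entire (\<open>entire_cubic_shift_rational\<close>). Each of the differences \<open>w = f (z + c) - f z\<close>,
  \<open>w' = f (z + 2 c) - f z\<close> and \<open>w' - w\<close> divides a nonzero polynomial, because
  \<open>H x - H y\<close> is divisible by \<open>x - y\<close>; in particular all three have finitely many zeros. By the great Picard
  theorem \<open>w / w'\<close> is rational. Then the two equations
  \<open>H (f + w) - H f = S (z + c) - S z\<close> and \<open>H (f + w') - H f = S (z + 2 c) - S z\<close> determine \<open>f\<close> rationally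
  in terms of \<open>w\<close> and give a nontrivial algebraic equation for \<open>w\<close> over the rational functions.
  By Liouville's theorem \<open>w\<close> is rational, and hence so is \<open>f\<close>.
\<close>

section \<open>Shifts, derivatives and polynomials\<close>

lemma cosparse_shift:
  fixes c :: complex
  assumes "\<forall>\<^sub>\<approx>z. P z"
  shows   "\<forall>\<^sub>\<approx>z. P (z + c)"
proof -
  have "eventually (\<lambda>z. P (z + c)) (at x)" for x
  proof -
    have "eventually P (at (x + c))" using assms by (simp add: eventually_cosparse_open_eq)
    thus ?thesis
      unfolding at_to_0[of x] at_to_0[of "x+c"] eventually_filtermap by (simp add: add_ac)
  qed
  thus ?thesis by (simp add: eventually_cosparse_open_eq)
qed

lemma meromorphic_shift:
  fixes c :: complex
  assumes "f meromorphic_on UNIV"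
  shows "(\<lambda>z. f (z + c)) meromorphic_on UNIV"
  by (rule meromorphic_on_compose[OF assms]) (auto intro!: analytic_intros)

text \<open>
  Two functions that agree off a closed discrete set agree near every point of the complement, so
  their derivatives agree there too, whatever they do on the exceptional set.
\<close>
lemma cosparse_deriv_cong:
  fixes f g :: "complex \<Rightarrow> complex"
  assumes "\<forall>\<^sub>\<approx>z. f z = g z"
  shows   "\<forall>\<^sub>\<approx>z. deriv f z = deriv g z"
proof -
  have "eventually (\<lambda>z. deriv f z = deriv g z) (at x)" for x
  proof -
    have "eventually (\<lambda>z. f z = g z) (at x)"
      using assms by (simp add: eventually_cosparse_open_eq)
    then obtain T where T: "open T" "x \<in> T" "\<forall>z\<in>T - {x}. f z = g z"
      unfolding eventually_at_topological by blast
    have "deriv f z = deriv g z" if "z \<in> T - {x}" for z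
    proof (rule deriv_cong_ev)
      show "eventually (\<lambda>w. f w = g w) (nhds z)"
        using T that by (intro eventually_nhds[THEN iffD2] exI[of _ "T - {x}"]) auto
    qed auto
    thus ?thesis using T unfolding eventually_at_topological by blast
  qed
  thus ?thesis by (simp add: eventually_cosparse_open_eq)
qed

lemma cosparse_higher_deriv_cong:
  fixes f g :: "complex \<Rightarrow> complex"
  assumes "\<forall>\<^sub>\<approx>z. f z = g z"
  shows   "\<forall>\<^sub>\<approx>z. (deriv ^^ k) f z = (deriv ^^ k) g z"
  by (induction k) (use assms cosparse_deriv_cong in auto)

text \<open>
  The exceptional points may be poles, so the usual argument on a connected domain of holomorphy
  is replaced by the identity theorem: \<open>h\<close> is constant on one small disc, and a meromorphic function
  that takes a value on a disc takes it off a sparse set.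
\<close>
lemma meromorphic_deriv_eq_0_imp_constant:
  fixes h :: "complex \<Rightarrow> complex"
  assumes h: "h meromorphic_on UNIV" and d: "\<forall>\<^sub>\<approx>z. deriv h z = 0"
  shows "\<exists>C. \<forall>\<^sub>\<approx>z. h z = C"
proof -
  have "\<forall>\<^sub>\<approx>z. h analytic_on {z}"
    using h by (rule meromorphic_on_imp_analytic_cosparse)
  hence "eventually (\<lambda>z. h analytic_on {z} \<and> deriv h z = 0) (at 0)"
    using d by (auto simp: eventually_cosparse_open_eq eventually_conj_iff)
  then obtain T where T: "open T" "0 \<in> T" "\<And>z. z \<in> T \<Longrightarrow> z \<noteq> 0 \<Longrightarrow> h analytic_on {z} \<and> deriv h z = 0"
    unfolding eventually_at_topological by blast
  from T(1,2) obtain r where r: "r > 0" "ball 0 r \<subseteq> T" by (meson open_contains_ball)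
  define x :: complex where "x = of_real (r/2)"
  have xin: "x \<in> ball 0 r - {0}" using r by (simp add: x_def)
  have "open (ball 0 r - {0::complex})" by auto
  then obtain e where e: "e > 0" "ball x e \<subseteq> ball 0 r - {0}"
    using xin by (meson open_contains_ball)
  have "\<exists>C. \<forall>z\<in>ball x e. h z = C"
  proof (rule has_field_derivative_zero_constant)
    fix y assume "y \<in> ball x e"
    hence y: "h analytic_on {y}" "deriv h y = 0" using T(3)[of y] r e(2) by (blast dest: subsetD)+
    thus "(h has_field_derivative 0) (at y within ball x e)"
      using analytic_derivI[OF y(1)] by simp
  qed auto
  hence "eventually (\<lambda>z. h z = h x) (at x)"
    unfolding eventually_at_topological using e(1) by (intro exI[of _ "ball x e"]) auto
  hence "\<not> (\<forall>\<^sub>\<approx>z. h z \<noteq> h x)"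
    using eventually_cosparse_imp_eventually_at[of "\<lambda>z. h z \<noteq> h x" UNIV x UNIV] 
     eventually_elim2[of "\<lambda>z. h z = h x" "at x" "\<lambda>z. h z \<noteq> h x" "\<lambda>_. False"] by auto
  thus ?thesis using meromorphic_imp_constant_or_avoid[OF h, of "h x"] by auto
qed

lemma poly_antiderivative:
  fixes p :: "complex poly"
  shows "\<exists>q. pderiv q = p"
proof -
  define q where "q = (\<Sum>i\<le>degree p. monom (coeff p i / of_nat (Suc i)) (Suc i))"
  have "pderiv q = (\<Sum>i\<le>degree p. monom (coeff p i) i)"
    by (simp add: q_def higher_pderiv_sum[of 1, simplified] pderiv_monom del: of_nat_Suc)
  thus ?thesis using poly_as_sum_of_monoms[of p] by auto
qed

lemma poly_analytic: "poly p analytic_on (A :: complex set)"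
  by (rule analytic_on_subset[of _ UNIV]) (auto simp: analytic_on_open intro!: holomorphic_intros)

lemma meromorphic_higher_deriv_eq_0_imp_poly:
  fixes h :: "complex \<Rightarrow> complex"
  assumes "h meromorphic_on UNIV" and "\<forall>\<^sub>\<approx>z. (deriv ^^ k) h z = 0"
  shows "\<exists>p. \<forall>\<^sub>\<approx>z. h z = poly p z"
  using assms
proof (induction k arbitrary: h)
  case 0
  thus ?case by (intro exI[of _ 0]) auto
next
  case (Suc k)
  have "(deriv ^^ k) (deriv h) = (deriv ^^ Suc k) h" by (simp add: funpow_swap1)
  hence "\<exists>p. \<forall>\<^sub>\<approx>z. deriv h z = poly p z"
    using Suc.prems by (intro Suc.IH meromorphic_intros) auto
  then obtain p where p: "\<forall>\<^sub>\<approx>z. deriv h z = poly p z" ..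
  obtain q where q: "pderiv q = p" using poly_antiderivative by blast
  have "\<forall>\<^sub>\<approx>z. h analytic_on {z}"
    using Suc.prems(1) by (rule meromorphic_on_imp_analytic_cosparse)
  with p have "\<forall>\<^sub>\<approx>z. deriv (\<lambda>z. h z - poly q z) z = 0"
  proof eventually_elim
    case (elim z)
    have "((\<lambda>z. h z - poly q z) has_field_derivative deriv h z - poly (pderiv q) z) (at z)"
      by (intro DERIV_diff analytic_derivI elim poly_DERIV)
    thus ?case using elim q by (simp add: DERIV_imp_deriv)
  qed
  moreover have "(\<lambda>z. h z - poly q z) meromorphic_on UNIV"
    by (intro meromorphic_on_diff Suc.prems(1) analytic_on_imp_meromorphic_on poly_analytic)
  ultimately obtain C where "\<forall>\<^sub>\<approx>z. h z - poly q z = C"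
    using meromorphic_deriv_eq_0_imp_constant by blast
  hence "\<forall>\<^sub>\<approx>z. h z = poly (q + [:C:]) z"
    by eventually_elim (auto simp: algebra_simps)
  thus ?case by blast
qed

lemma higher_deriv_shift:
  "(deriv ^^ k) (\<lambda>z. f (z + c)) = (\<lambda>z. (deriv ^^ k) f (z + c))" for c :: complex
proof (induction k)
  case (Suc k)
  have "deriv (\<lambda>z. g (z + c)) = (\<lambda>z. deriv g (z + c))" for g :: "complex \<Rightarrow> complex"
    by (simp add: fun_eq_iff deriv_def DERIV_shift)
  thus ?case using Suc by simp
qed simp_all

lemma periodic_higher_deriv_imp_shift_diff_poly:
  fixes F :: "complex \<Rightarrow> complex"
  assumes F: "F meromorphic_on UNIV"
    and per: "\<forall>\<^sub>\<approx>z. (deriv ^^ k) F (z + c) = (deriv ^^ k) F z"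
  shows "\<exists>p. \<forall>\<^sub>\<approx>z. F (z + c) - F z = poly p z"
proof (rule meromorphic_higher_deriv_eq_0_imp_poly[where k = k])
  show "(\<lambda>z. F (z + c) - F z) meromorphic_on UNIV"
    by (intro meromorphic_on_diff meromorphic_shift F)
  have "\<forall>\<^sub>\<approx>z. F analytic_on {z}" "\<forall>\<^sub>\<approx>z. (\<lambda>z. F (z + c)) analytic_on {z}"
    using F meromorphic_shift[OF F] by (auto intro: meromorphic_on_imp_analytic_cosparse)
  with per show "\<forall>\<^sub>\<approx>z. (deriv ^^ k) (\<lambda>z. F (z + c) - F z) z = 0"
  proof eventually_elim
    case (elim z)
    thus ?case using higher_deriv_diff_at[of "\<lambda>z. F (z + c)" z F k]
      by (simp add: higher_deriv_shift)
  qed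
qed

text \<open>
  By the binomial theorem, \<open>(z + c)\<^sup>n\<^sup>+\<^sup>1 - z\<^sup>n\<^sup>+\<^sup>1\<close> is \<open>(n + 1) c z\<^sup>n\<close> plus lower powers of \<open>z\<close>, and the
  lower powers are differences by induction.
\<close>
lemma monomial_eq_shift_diff:
  fixes c :: complex
  assumes c: "c \<noteq> 0"
  shows "\<exists>S. \<forall>z. poly S (z + c) - poly S z = z ^ n"
proof (induction n rule: less_induct)
  case (less n)
  then obtain T where T: "\<And>j z. j < n \<Longrightarrow> poly (T j) (z + c) - poly (T j) z = z ^ j"
    by metis
  define a where "a = (\<lambda>j. of_nat (Suc n choose j) * c ^ (Suc n - j))"
  have a: "a n = of_nat (Suc n) * c" "a n \<noteq> 0" using c by (auto simp: a_def simp del: of_nat_Suc)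
  define S where "S = smult (1 / a n) (monom 1 (Suc n) - (\<Sum>j<n. smult (a j) (T j)))"
  have "poly S (z + c) - poly S z = z ^ n" for z
  proof -
    have "(z + c) ^ Suc n = (\<Sum>j\<le>Suc n. a j * z ^ j)"
      by (subst binomial_ring) (simp add: a_def mult_ac)
    also have "\<dots> = (\<Sum>j<n. a j * z ^ j) + a n * z ^ n + z ^ Suc n"
      by (simp add: a_def lessThan_Suc_atMost [symmetric] del: binomial_Suc_Suc power_Suc)
    finally have b: "(z + c) ^ Suc n - z ^ Suc n = (\<Sum>j<n. a j * z ^ j) + a n * z ^ n" by simp
    have "poly S (z + c) - poly S z = 1 / a n * (((z + c) ^ Suc n - z ^ Suc n)
              - (\<Sum>j<n. a j * (poly (T j) (z + c) - poly (T j) z)))"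
      by (simp add: S_def poly_sum poly_monom right_diff_distrib sum_subtractf del: power_Suc)
    also have "\<dots> = z ^ n" unfolding b using T a(2) by simp
    finally show ?thesis .
  qed
  thus ?case by blast
qed

lemma poly_eq_shift_diff:
  fixes c :: complex
  assumes c: "c \<noteq> 0"
  shows "\<exists>S. \<forall>z. poly S (z + c) - poly S z = poly P z"
proof -
  obtain T where T: "\<And>j z. poly (T j) (z + c) - poly (T j) z = z ^ j"
    using monomial_eq_shift_diff[OF c] by metis
  define S where "S = (\<Sum>j\<le>degree P. smult (coeff P j) (T j))"
  have "poly S (z + c) - poly S z = (\<Sum>j\<le>degree P. coeff P j * (poly (T j) (z + c) - poly (T j) z))" for z
    by (simp add: S_def poly_sum right_diff_distrib sum_subtractf)
  thus ?thesis using T by (auto simp: poly_altdef)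
qed

lemma periodic_poly_imp_constant:
  fixes S :: "complex poly"
  assumes c: "c \<noteq> 0" and per: "\<And>z. poly S (z + c) = poly S z"
  shows "degree S = 0"
proof (rule ccontr)
  assume "degree S \<noteq> 0"
  \<comment> \<open>This polynomial vanishes at all multiples of \<open>c\<close>.\<close>
  define R where "R = S - [:poly S 0:]"
  have "R \<noteq> 0"
  proof
    assume "R = 0"
    hence "S = [:poly S 0:]" by (simp add: R_def)
    hence "degree S = 0" by (metis degree_pCons_0)
    thus False using \<open>degree S \<noteq> 0\<close> by simp
  qed
  have "poly S (of_nat n * c) = poly S 0" for n
    by (induction n) (use per[of "of_nat _ * c"] in \<open>auto simp: algebra_simps\<close>)
  hence "range (\<lambda>n. of_nat n * c) \<subseteq> {z. poly R z = 0}" by (auto simp: R_def)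
  moreover have "inj (\<lambda>n. of_nat n * c)" using c by (auto simp: inj_on_def)
  ultimately show False
    using poly_roots_finite[OF \<open>R \<noteq> 0\<close>] by (meson finite_subset infinite_UNIV_nat range_inj_infinite)
qed

section \<open>Functions with a periodic polynomial image\<close>

text \<open>
  For generic \<open>z\<close> the numbers \<open>f (z + j c)\<close>, \<open>j = 0, \<dots>, degree H\<close>, are all roots of the polynomial
  \<open>H - H (f z)\<close>, which has at most \<open>degree H\<close> of them. If no two of these shifts of \<open>f\<close>
  coincided as meromorphic functions, then for generic \<open>z\<close> they would have pairwise distinct values.
\<close>
lemma poly_value_repeats_imp_periodic:
  fixes f :: "complex \<Rightarrow> complex" and H :: "complex poly"
  assumes f: "f meromorphic_on UNIV" and H: "degree H > 0" and c: "c \<noteq> 0"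
    and rep: "\<forall>\<^sub>\<approx>z. poly H (f (z + c)) = poly H (f z)"
  shows "\<exists>c'. c' \<noteq> 0 \<and> (\<forall>\<^sub>\<approx>z. f (z + c') = f z)"
proof (rule ccontr)
  assume no: "\<nexists>c'. c' \<noteq> 0 \<and> (\<forall>\<^sub>\<approx>z. f (z + c') = f z)"
  define n where "n = degree H"
  have Hne: "H - [:a:] \<noteq> 0" for a
    using H by (metis degree_pCons_0 eq_iff_diff_eq_0 less_irrefl)
  define g where "g = (\<lambda>j z. f (z + of_nat j * c))"
  have mer: "g j meromorphic_on UNIV" for j
    unfolding g_def by (rule meromorphic_shift[OF f])
  have distinct: "\<forall>\<^sub>\<approx>z. g i z \<noteq> g j z" if "i < j" for i j
  proof -
    have "\<not> (\<forall>\<^sub>\<approx>z. g j z - g i z = 0)"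
    proof
      assume "\<forall>\<^sub>\<approx>z. g j z - g i z = 0"
      hence "\<forall>\<^sub>\<approx>z. g j (z + - of_nat i * c) - g i (z + - of_nat i * c) = 0"
        by (rule cosparse_shift)
      hence "\<forall>\<^sub>\<approx>z. f (z + of_nat (j - i) * c) = f z"
        using that by (simp add: g_def of_nat_diff algebra_simps)
      moreover have "of_nat (j - i) * c \<noteq> 0" using that c by simp
      ultimately show False using no by blast
    qed
    hence "\<forall>\<^sub>\<approx>z. g j z - g i z \<noteq> 0"
      using meromorphic_imp_constant_or_avoid[of "\<lambda>z. g j z - g i z" UNIV 0] mer
      by (auto intro: meromorphic_on_diff)
    thus ?thesis by eventually_elim auto
  qed
  have "\<forall>\<^sub>\<approx>z. poly H (g j z) = poly H (f z)" for j
  proof (induction j)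
    case (Suc j)
    have "\<forall>\<^sub>\<approx>z. poly H (f (z + of_nat j * c + c)) = poly H (f (z + of_nat j * c))"
      using rep by (rule cosparse_shift)
    with Suc show ?case by eventually_elim (simp add: g_def algebra_simps)
  qed (simp add: g_def)
  hence "\<forall>\<^sub>\<approx>z. \<forall>j\<in>{..n}. poly H (g j z) = poly H (f z)"
    by (intro eventually_ball_finite) auto
  moreover have "\<forall>\<^sub>\<approx>z. \<forall>j\<in>{..n}. \<forall>i\<in>{..<j}. g i z \<noteq> g j z"
    by (intro eventually_ball_finite ballI distinct) auto
  ultimately have "\<forall>\<^sub>\<approx>z::complex. False"
  proof eventually_elim
    case (elim z)
    have "inj_on (\<lambda>j. g j z) {..n}"
      using elim(2) by (intro linorder_inj_onI) auto
    hence "Suc n = card ((\<lambda>j. g j z) ` {..n})" by (simp add: card_image)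
    also have "\<dots> \<le> card {y. poly (H - [:poly H (f z):]) y = 0}"
      using elim(1) by (intro card_mono poly_roots_finite Hne) auto
    also have "\<dots> \<le> degree (H - [:poly H (f z):])"
      by (intro card_poly_roots_bound Hne)
    also have "\<dots> \<le> n" by (intro degree_diff_le) (auto simp: n_def)
    finally show False by simp
  qed
  thus False by (simp add: eventually_False)
qed

section \<open>Exclusion of poles\<close>

text \<open>
  The functions \<open>f n\<close> stand for the translates \<open>z \<mapsto> f (z + n c)\<close> near a pole \<open>p\<close>. Fix a critical point
  \<open>x\<close> of \<open>H\<close>. For large \<open>n\<close>, two facts contradict each other.
  
  The function \<open>f n\<close> takes the value \<open>x\<close> near \<open>p\<close>: otherwise \<open>t = 1 / (f n - x)\<close> is holomorphic near
  \<open>p\<close> with \<open>t p = 0\<close>, while on a fixed circle around \<open>p\<close> the term \<open>S (z + n c)\<close> dominates, so that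
  \<open>S (z + n c) t\<^sup>d\<close> is close to the nonzero leading coefficient of \<open>H\<close>, where \<open>d = degree H\<close>. A
  holomorphic function that nearly equals a nonzero constant on the circle cannot vanish at the centre.
  
  But at a point where \<open>f n = x\<close>, both \<open>H (f n)\<close> has a prescribed value \<open>v = H x\<close> and its derivative
  vanishes, so \<open>G = v - S\<close> and \<open>G' = - S'\<close> there (with \<open>S\<close> taken at the translated point). This is
  impossible, because \<open>G' / G\<close> is large near the pole of \<open>G\<close>, whereas \<open>S' / (S - v)\<close> is small near
  infinity.
\<close>
lemma no_pole_if_shifts_differ_by_poly_local:
  fixes H S :: "complex poly" and f :: "nat \<Rightarrow> complex \<Rightarrow> complex"
  assumes R: "R > 0" and G: "G holomorphic_on ball p R - {p}" "is_pole G p"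
    and f: "\<And>n. f n holomorphic_on ball p R - {p}" "\<And>n. is_pole (f n) p"
    and eq: "\<And>n z. z \<in> ball p R - {p} \<Longrightarrow> poly H (f n z) = G z + poly S (z + of_nat n * c)"
    and S: "degree S > 0" and c: "c \<noteq> 0" and H: "degree H \<ge> 2"
  shows False
proof -
  have "degree (pderiv H) \<noteq> 0" using H by (simp add: degree_pderiv)
  then obtain x where x: "poly (pderiv H) x = 0"
    using fundamental_theorem_of_algebra_alt[of "pderiv H"]
    by (metis degree_pCons_0 pCons_0_0)
  define v where "v = poly H x"
  define d where "d = degree H"
  \<comment> \<open>In terms of \<open>t = 1 / (y - x)\<close>, the value \<open>H y\<close> is \<open>\<rho> t / t\<^sup>d\<close>, and \<open>\<rho> 0\<close> is the leading coefficient of \<open>H\<close>.\<close>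
  define \<rho> where "\<rho> = reflect_poly (H \<circ>\<^sub>p [:x, 1:])"
  define \<rho>0 where "\<rho>0 = poly \<rho> 0"
  have \<rho>0: "\<rho>0 \<noteq> 0"
    using H by (auto simp: \<rho>0_def \<rho>_def lead_coeff_comp)
  have \<rho>: "poly H y * inverse (y - x) ^ d = poly \<rho> (inverse (y - x))" if "y \<noteq> x" for y
    using that by (simp add: \<rho>_def poly_reflect_poly_nz poly_pcompose d_def degree_pcompose)

  have "isolated_singularity_at G p"
    using isolated_singularity_at_holomorphic[OF G(1)] R by auto
  hence "is_pole (\<lambda>z. deriv G z / G z) p"
    using G(2) by (rule is_pole_deriv_divide_is_pole)
  hence "eventually (\<lambda>z. norm (deriv G z / G z) \<ge> 1) (at p)"
    by (auto simp: is_pole_def filterlim_at_infinity[OF order_refl])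
  hence "eventually (\<lambda>z. norm (G z) \<le> norm (deriv G z)) (at p)"
    by eventually_elim (auto simp: norm_divide divide_simps split: if_splits)
  then obtain r' where r': "r' > 0"
      "\<And>z. z \<noteq> p \<Longrightarrow> dist z p < r' \<Longrightarrow> norm (G z) \<le> norm (deriv G z)"
    unfolding eventually_at by auto
  define r2 where "r2 = min r' R"
  define r where "r = r2 / 2"
  have r: "r > 0" "r < r2" "r2 \<le> r'" "r2 \<le> R" using R r'(1) by (auto simp: r2_def r_def)
  have sub: "sphere p r \<subseteq> ball p R - {p}" "ball p r2 - {p} \<subseteq> ball p R - {p}"
    using r by auto

  have "degree (S - [:v:]) = degree S" unfolding diff_conv_add_uminus
    by (rule degree_add_eq_left) (use S in simp)
  moreover have "degree (pderiv S) < degree S" using S by (simp add: degree_pderiv)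
  ultimately have "((\<lambda>y. poly (pderiv S) y / poly (S - [:v:]) y) \<longlongrightarrow> 0) at_infinity"
    by (intro poly_divide_tendsto_0_at_infinity) simp
  hence ev1: "eventually (\<lambda>y. norm (poly (pderiv S) y / poly (S - [:v:]) y) < 1) at_infinity"
    using order_tendstoD(2)[OF tendsto_norm, of _ 0 at_infinity 1] by auto
  have Slim: "filterlim (poly S) at_infinity at_infinity"
    using S by (rule filterlim_poly_at_infinity)
  have ev2: "eventually (\<lambda>y. norm (poly S y) \<ge> norm v + 1) at_infinity"
    using Slim by (auto simp: filterlim_at_infinity[OF order_refl] add_nonneg_pos)
  have ev: "eventually (\<lambda>y. norm (poly (pderiv S) y) < norm (v - poly S y)) at_infinity"
    using ev1 ev2
    by eventually_elim (auto simp: norm_divide divide_simps norm_minus_commute split: if_splits)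

  have "bounded (G ` sphere p r)"
    using G(1) sub(1)
    by (intro compact_imp_bounded compact_continuous_image)
       (auto intro: holomorphic_on_imp_continuous_on holomorphic_on_subset)
  then obtain M where M: "M > 0" "\<And>z. z \<in> sphere p r \<Longrightarrow> norm (G z) \<le> M"
    unfolding bounded_pos by auto
  \<comment> \<open>If \<open>|t| \<le> \<tau>\<close> on the circle, then \<open>|G t\<^sup>d| \<le> |\<rho> 0| / 2\<close> there.\<close>
  define \<tau> where "\<tau> = min 1 (norm \<rho>0 / (2 * M))"
  have \<tau>: "\<tau> > 0" "\<tau> \<le> 1" "M * \<tau> \<le> norm \<rho>0 / 2"
  proof -
    have "M * \<tau> \<le> M * (norm \<rho>0 / (2 * M))" using M(1) by (intro mult_left_mono) (auto simp: \<tau>_def)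
    thus "M * \<tau> \<le> norm \<rho>0 / 2" using M(1) by simp
  qed (use M(1) \<rho>0 in \<open>auto simp: \<tau>_def\<close>)
  have "bounded (poly H ` cball x (1 / \<tau>))"
    by (intro compact_imp_bounded compact_continuous_image continuous_intros) auto
  then obtain K where K: "K > 0" "\<And>y. y \<in> cball x (1 / \<tau>) \<Longrightarrow> norm (poly H y) \<le> K"
    unfolding bounded_pos by auto
  have "eventually (\<lambda>y. norm (poly S y) \<ge> M + K + 1) at_infinity"
    using Slim M(1) K(1) by (auto simp: filterlim_at_infinity[OF order_refl])
  with ev have "eventually (\<lambda>y. norm (poly S y) \<ge> M + K + 1 \<and> 
      norm (poly (pderiv S) y) < norm (v - poly S y)) at_infinity" by eventually_elim auto
  then obtain B where B: "\<And>y. norm y \<ge> B \<Longrightarrow> norm (poly S y) \<ge> M + K + 1"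
      "\<And>y. norm y \<ge> B \<Longrightarrow> norm (poly (pderiv S) y) < norm (v - poly S y)"
    unfolding eventually_at_infinity by auto
  \<comment> \<open>With this \<open>n\<close>, the translate of the whole disc lies in the region where the bounds on \<open>S\<close> hold.\<close>
  obtain n :: nat where "real n > (B + norm p + R) / norm c" using reals_Archimedean2 by blast
  hence n: "real n * norm c > B + norm p + R" using c by (simp add: field_simps)
  have far: "norm (z + of_nat n * c) \<ge> B" if "z \<in> ball p R" for z
  proof -
    have "norm (of_nat n * c) \<le> norm (z + of_nat n * c) + norm (z - p) + norm p"
      by (smt (verit, best) add_diff_cancel_left' norm_triangle_ineq norm_triangle_ineq4 diff_add_cancel)
    thus ?thesis using that n by (simp add: norm_mult dist_norm norm_minus_commute)
  qed

  show False
  proof (cases "\<exists>w\<in>ball p r2 - {p}. f n w = x")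
    case True
    then obtain w where w: "w \<in> ball p r2 - {p}" "f n w = x" by blast
    have wR: "w \<in> ball p R - {p}" using w sub by blast
    have op: "open (ball p R - {p})" by auto
    have "((\<lambda>z. poly H (f n z)) has_field_derivative poly (pderiv H) (f n w) * deriv (f n) w) (at w)"
      using DERIV_chain2[OF poly_DERIV holomorphic_derivI[OF f(1) op wR]] by blast
    moreover have "((\<lambda>z. G z + poly S (z + of_nat n * c)) has_field_derivative
        deriv G w + poly (pderiv S) (w + of_nat n * c)) (at w)"
      using holomorphic_derivI[OF G(1) op wR] poly_DERIV[of S "w + of_nat n * c"]
      by (intro DERIV_add) (auto simp: DERIV_shift)
    hence "((\<lambda>z. poly H (f n z)) has_field_derivative
        deriv G w + poly (pderiv S) (w + of_nat n * c)) (at w)"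
      by (rule has_field_derivative_transform_within_open[OF _ op wR]) (simp add: eq)
    ultimately have "deriv G w + poly (pderiv S) (w + of_nat n * c) = 0"
      using w(2) x DERIV_unique by fastforce
    hence "norm (deriv G w) = norm (poly (pderiv S) (w + of_nat n * c))"
      by (metis add_eq_0_iff norm_minus_cancel)
    also have "\<dots> < norm (v - poly S (w + of_nat n * c))"
      using wR by (intro B far) auto
    also have "v - poly S (w + of_nat n * c) = G w"
      using eq[OF wR, of n] w(2) by (simp add: v_def)
    also have "norm (G w) \<le> norm (deriv G w)"
      using w r by (intro r') (auto simp: dist_commute)
    finally show False by simp
  next
    case False
    define t where "t = (\<lambda>z. if z = p then 0 else inverse (f n z - x))"
    \<comment> \<open>The relation between \<open>f n\<close>, \<open>G\<close> and \<open>S\<close> gives \<open>L = - G t\<^sup>d\<close> off \<open>p\<close>, which is small on the circle,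
      whereas \<open>L p = - \<rho> 0\<close>.\<close>
    define L where "L = (\<lambda>z. poly S (z + of_nat n * c) * t z ^ d - poly \<rho> (t z))"
    have "t holomorphic_on ball p r2"
      unfolding t_def using False sub(2)
      by (intro is_pole_inverse_holomorphic holomorphic_intros holomorphic_on_subset[OF f(1)])
         (auto simp: is_pole_minus_const_iff f(2))
    hence L: "L holomorphic_on ball p r2"
      unfolding L_def by (intro holomorphic_intros holomorphic_on_compose[of t _ "poly \<rho>", unfolded o_def]) auto
    have "norm (L p) \<le> norm \<rho>0 / 2"
    proof (rule maximum_modulus_frontier[of L "ball p r"])
      show "L holomorphic_on interior (ball p r)"
        using L by (rule holomorphic_on_subset) (use r in auto)
      show "continuous_on (closure (ball p r)) L"
        using holomorphic_on_imp_continuous_on[OF L] by (rule continuous_on_subset) (use r in auto)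
    next
      fix z assume "z \<in> frontier (ball p r)"
      hence z: "z \<in> sphere p r" using r by simp
      hence z': "z \<in> ball p R - {p}" "z \<in> ball p r2 - {p}" using r by auto
      have "M + K + 1 \<le> norm (poly S (z + of_nat n * c))"
        using z' by (intro B far) auto
      also have "\<dots> = norm (poly H (f n z) - G z)" using eq[OF z'(1), of n] by simp
      also have "\<dots> \<le> norm (poly H (f n z)) + M"
        using M(2)[OF z] norm_triangle_ineq4[of "poly H (f n z)" "G z"] by linarith
      finally have "norm (poly H (f n z)) > K" by simp
      hence "f n z \<notin> cball x (1 / \<tau>)" using K(2) by force
      hence "norm (f n z - x) > 1 / \<tau>" by (simp add: dist_norm norm_minus_commute)
      hence t: "norm (t z) \<le> \<tau>"
        using \<tau> z' less_imp_inverse_less[of "1 / \<tau>" "norm (f n z - x)"]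
        by (auto simp: t_def norm_inverse)
      have "poly \<rho> (t z) = poly H (f n z) * t z ^ d"
        using False z' \<rho>[of "f n z"] by (auto simp: t_def)
      hence "L z = - G z * t z ^ d"
        unfolding L_def eq[OF z'(1)] by (simp add: algebra_simps)
      hence "norm (L z) = norm (G z) * norm (t z) ^ d" by (simp add: norm_mult norm_power)
      also have "\<dots> \<le> M * \<tau> ^ 1"
      proof (intro mult_mono)
        have "norm (t z) ^ d \<le> \<tau> ^ d" using t by (intro power_mono) auto
        also have "\<dots> \<le> \<tau> ^ 1" using \<tau> H by (intro power_decreasing) (auto simp: d_def)
        finally show "norm (t z) ^ d \<le> \<tau> ^ 1" .
      qed (use M z \<tau> in auto)
      finally show "norm (L z) \<le> norm \<rho>0 / 2" using \<tau> by simp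
    qed (use r in auto)
    moreover have "L p = - \<rho>0"
      using H by (simp add: L_def t_def \<rho>0_def d_def)
    ultimately show False using \<rho>0 by simp
  qed
qed

section \<open>Entire functions of polynomial growth\<close>

lemma poly_growth:
  fixes p :: "complex poly"
  shows "\<exists>B. \<forall>z. norm z \<ge> 1 \<longrightarrow> norm (poly p z) \<le> B * norm z ^ degree p"
proof (intro exI allI impI)
  fix z :: complex assume z: "norm z \<ge> 1"
  have "norm (poly p z) \<le> (\<Sum>i\<le>degree p. norm (coeff p i) * norm z ^ i)"
    unfolding poly_altdef by (rule order_trans[OF norm_sum]) (simp add: norm_mult norm_power)
  also have "\<dots> \<le> (\<Sum>i\<le>degree p. norm (coeff p i) * norm z ^ degree p)"
    using z by (intro sum_mono mult_left_mono power_increasing) auto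
  finally show "norm (poly p z) \<le> (\<Sum>i\<le>degree p. norm (coeff p i)) * norm z ^ degree p"
    by (simp add: sum_distrib_right)
qed

text \<open>
  Liouville's theorem, with a bound that is a finite sum of moduli of polynomials because this is
  the form in which the bounds below arise.
\<close>
lemma entire_bounded_by_poly_imp_poly:
  fixes f :: "complex \<Rightarrow> complex" and p :: "'i \<Rightarrow> complex poly"
  assumes f: "f holomorphic_on UNIV" and I: "finite I"
    and le: "eventually (\<lambda>z. norm (f z) \<le> M + (\<Sum>i\<in>I. norm (poly (p i) z))) at_infinity"
  shows "\<exists>q :: complex poly. \<forall>z. f z = poly q z"
proof -
  have "\<forall>i. \<exists>b. \<forall>z. norm z \<ge> 1 \<longrightarrow> norm (poly (p i) z) \<le> b * norm z ^ degree (p i)"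
    by (intro allI poly_growth)
  from choice[OF this] obtain B where
    B: "\<And>i z. norm z \<ge> 1 \<Longrightarrow> norm (poly (p i) z) \<le> B i * norm z ^ degree (p i)" by blast
  define n where "n = Max (insert 0 (degree ` p ` I))"
  have n: "degree (p i) \<le> n" if "i \<in> I" for i
    using that I by (auto simp: n_def intro!: Max_ge)
  from le obtain A where A: "\<And>z. norm z \<ge> A \<Longrightarrow> norm (f z) \<le> M + (\<Sum>i\<in>I. norm (poly (p i) z))"
    by (auto simp: eventually_at_infinity)
  have bd: "norm (f z) \<le> (\<bar>M\<bar> + (\<Sum>i\<in>I. \<bar>B i\<bar>)) * norm z ^ n" if z: "norm z \<ge> max 1 A" for z
  proof -
    have "norm (poly (p i) z) \<le> \<bar>B i\<bar> * norm z ^ n" if "i \<in> I" for i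
    proof -
      have "norm (poly (p i) z) \<le> B i * norm z ^ degree (p i)" using z by (intro B) auto
      also have "\<dots> \<le> \<bar>B i\<bar> * norm z ^ n"
        using n[OF that] z by (intro mult_mono power_increasing) auto
      finally show ?thesis .
    qed
    hence "(\<Sum>i\<in>I. norm (poly (p i) z)) \<le> (\<Sum>i\<in>I. \<bar>B i\<bar> * norm z ^ n)"
      by (intro sum_mono) auto
    moreover have "M \<le> \<bar>M\<bar> * norm z ^ n"
      using z mult_left_mono[of 1 "norm z ^ n" "\<bar>M\<bar>"] one_le_power[of "norm z" n] by simp
    ultimately show ?thesis
      using A[of z] z by (simp add: sum_distrib_right distrib_right)
  qed
  have "f z = poly (\<Sum>k\<le>n. monom ((deriv ^^ k) f 0 / fact k) k) z" for z
    using Liouville_polynomial[where A = "max 1 A" and \<xi> = z, OF f bd] by (simp add: poly_sum poly_monom)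
  thus ?thesis by blast
qed

text \<open>
  Multiplying a root by the leading coefficient of its equation makes it integral over the
  polynomials: \<open>y = c N * v\<close> satisfies a monic equation with coefficients \<open>D i\<close>, and a root of a
  monic polynomial is at most one plus the sum of the moduli of the other coefficients.
\<close>
lemma entire_algebraic_imp_rational:
  fixes c :: "nat \<Rightarrow> complex poly"
  assumes v: "v holomorphic_on UNIV" and N: "N > 0"
    and eq: "\<And>z. (\<Sum>i\<le>N. poly (c i) z * v z ^ i) = 0"
  shows "\<exists>q. \<forall>z. poly (c N) z * v z = poly q z"
proof -
  define y where "y = (\<lambda>z. poly (c N) z * v z)"
  define D where "D = (\<lambda>i. c i * c N ^ (N - 1 - i))"
  have "norm (y z) \<le> 1 + (\<Sum>i<N. norm (poly (D i) z))" for z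
  proof (cases "norm (y z) \<le> 1")
    case True
    moreover have "(\<Sum>i<N. norm (poly (D i) z)) \<ge> 0" by (intro sum_nonneg) auto
    ultimately show ?thesis by linarith
  next
    case False
    have "0 = poly (c N) z ^ (N - 1) * (\<Sum>i\<le>N. poly (c i) z * v z ^ i)" by (simp add: eq)
    also have "\<dots> = poly (c N) z ^ (N - 1) * (poly (c N) z * v z ^ N)
                  + (\<Sum>i<N. poly (c N) z ^ (N - 1) * (poly (c i) z * v z ^ i))"
      by (simp add: lessThan_Suc_atMost[symmetric] distrib_left sum_distrib_left)
    also have "poly (c N) z ^ (N - 1) * (poly (c N) z * v z ^ N) = y z ^ N"
      using N by (cases N) (auto simp: y_def power_mult_distrib)
    also have "(\<Sum>i<N. poly (c N) z ^ (N - 1) * (poly (c i) z * v z ^ i)) = (\<Sum>i<N. poly (D i) z * y z ^ i)"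
    proof (rule sum.cong)
      fix i assume i: "i \<in> {..<N}"
      have "poly (c N) z ^ (N - 1) = poly (c N) z ^ (N - 1 - i) * poly (c N) z ^ i"
        using i by (subst power_add[symmetric]) auto
      thus "poly (c N) z ^ (N - 1) * (poly (c i) z * v z ^ i) = poly (D i) z * y z ^ i"
        by (simp add: D_def y_def power_mult_distrib)
    qed auto
    finally have "y z ^ N = - (\<Sum>i<N. poly (D i) z * y z ^ i)"
      by (simp add: add_eq_0_iff2)
    hence "norm (y z) ^ N = norm (\<Sum>i<N. poly (D i) z * y z ^ i)"
      by (metis norm_minus_cancel norm_power)
    also have "\<dots> \<le> (\<Sum>i<N. norm (poly (D i) z) * norm (y z) ^ i)"
      by (rule order_trans[OF norm_sum]) (simp add: norm_mult norm_power)
    also have "\<dots> \<le> (\<Sum>i<N. norm (poly (D i) z) * norm (y z) ^ (N - 1))"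
      using False by (intro sum_mono mult_left_mono power_increasing) auto
    finally have "norm (y z) * norm (y z) ^ (N - 1) \<le> (\<Sum>i<N. norm (poly (D i) z)) * norm (y z) ^ (N - 1)"
      using N by (simp add: sum_distrib_right power_Suc[symmetric] del: power_Suc)
    moreover have "norm (y z) ^ (N - 1) > 0" using False by (intro zero_less_power) auto
    ultimately have "norm (y z) \<le> (\<Sum>i<N. norm (poly (D i) z))" by simp
    thus ?thesis by simp
  qed
  moreover have "y holomorphic_on UNIV" unfolding y_def by (intro holomorphic_intros v)
  ultimately have "\<exists>q. \<forall>z. y z = poly q z"
    by (intro entire_bounded_by_poly_imp_poly[of y "{..<N}" 1 D]) auto
  thus ?thesis by (simp add: y_def)
qed

section \<open>The entire case\<close>

text \<open>
  The entire function \<open>w1 v2 = (w1 / w2) P2\<close> has polynomial growth because the quotient is bounded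
  near infinity, so it is a polynomial \<open>A\<close>, and \<open>w1 / w2 = A / P2\<close>.
\<close>
lemma entire_bounded_quotient:
  assumes w1: "w1 holomorphic_on UNIV" and v2: "v2 holomorphic_on UNIV"
    and P2: "\<And>z. w2 z * v2 z = poly P2 z"
    and nz: "eventually (\<lambda>z. w2 z \<noteq> 0) at_infinity"
    and lim: "((\<lambda>z. w1 z / w2 z) \<longlongrightarrow> l) at_infinity"
  shows "\<exists>A. \<forall>z. poly P2 z * w1 z = poly A z * w2 z \<and> poly A z = w1 z * v2 z"
proof -
  have "eventually (\<lambda>z. norm (w1 z / w2 z) < norm l + 1) at_infinity"
    by (rule order_tendstoD(2)[OF tendsto_norm[OF lim]]) simp
  with nz have "eventually (\<lambda>z. norm (w1 z * v2 z) \<le> 0 + (\<Sum>i\<in>{0::nat}. norm (poly (smult (of_real (norm l + 1)) P2) z))) at_infinity"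
  proof eventually_elim
    case (elim z)
    have "w1 z * v2 z = (w1 z / w2 z) * poly P2 z" using elim(1) by (simp add: P2[symmetric])
    hence "norm (w1 z * v2 z) = norm (w1 z / w2 z) * norm (poly P2 z)" by (simp only: norm_mult)
    also have "\<dots> \<le> (norm l + 1) * norm (poly P2 z)"
      using elim(2) by (intro mult_right_mono) auto
    also have "\<dots> = norm (of_real (norm l + 1) * poly P2 z)"
      by (simp only: norm_mult norm_of_real) simp
    finally show ?case by simp
  qed
  from entire_bounded_by_poly_imp_poly[OF _ _ this] have "\<exists>A. \<forall>z. w1 z * v2 z = poly A z"
    by (auto intro: holomorphic_intros w1 v2)
  then obtain A where A: "\<And>z. w1 z * v2 z = poly A z" by blast
  show ?thesis
    by (intro exI[of _ A]) (simp add: A[symmetric] P2[symmetric])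
qed

lemma eventually_poly_nonzero:
  fixes p :: "complex poly"
  assumes "p \<noteq> 0"
  shows "eventually (\<lambda>z. poly p z \<noteq> 0) at_infinity"
proof -
  have "bounded {z. poly p z = 0}" using poly_roots_finite[OF assms] by (rule finite_imp_bounded)
  then obtain B where "\<And>z. poly p z = 0 \<Longrightarrow> norm z \<le> B" unfolding bounded_iff by auto
  hence "norm z \<ge> B + 1 \<Longrightarrow> poly p z \<noteq> 0" for z by force
  thus ?thesis unfolding eventually_at_infinity by blast
qed

text \<open>
  The quotient \<open>wa / wb\<close> is holomorphic near infinity and omits \<open>0\<close> and \<open>1\<close> there, because \<open>wa\<close>, \<open>wb\<close>
  and \<open>wb - wa\<close> have only finitely many zeros. By the great Picard theorem it or its reciprocal is
  bounded near infinity, and so it is a rational function.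
\<close>
lemma entire_divisors_of_polys:
  assumes hol: "wa holomorphic_on UNIV" "wb holomorphic_on UNIV" "va holomorphic_on UNIV" "vb holomorphic_on UNIV"
    and P: "Pa \<noteq> 0" "Pb \<noteq> 0" "Pc \<noteq> 0"
    and eq: "\<And>z. wa z * va z = poly Pa z" "\<And>z. wb z * vb z = poly Pb z"
            "\<And>z. (wb z - wa z) * vc z = poly Pc z"
  shows "\<exists>A B. A \<noteq> 0 \<and> B \<noteq> 0 \<and> (\<forall>z. poly B z * wa z = poly A z * wb z)"
proof -
  have "eventually (\<lambda>z. poly (Pa * Pb * Pc) z \<noteq> 0) at_infinity"
    using P by (intro eventually_poly_nonzero) auto
  hence nz: "eventually (\<lambda>z. wa z \<noteq> 0 \<and> wb z \<noteq> 0 \<and> wa z \<noteq> wb z \<and> va z \<noteq> 0 \<and> vb z \<noteq> 0) at_infinity"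
    by eventually_elim (auto simp: eq[symmetric])
  then obtain R where R: "R > 0" "\<And>z. norm z \<ge> R \<Longrightarrow> wa z \<noteq> 0 \<and> wb z \<noteq> 0 \<and> wa z \<noteq> wb z"
    unfolding eventually_at_infinity_pos by auto
  define q where "q = (\<lambda>z. wa z / wb z)"
  have inv: "norm (inverse \<zeta>) \<ge> R" if "\<zeta> \<in> ball 0 (1 / R) - {0}" for \<zeta> :: complex
    using that R(1) less_imp_inverse_less[of "norm \<zeta>" "1 / R"] by (auto simp: norm_inverse)
  have "(q \<circ> inverse) holomorphic_on ball 0 (1 / R) - {0}"
    unfolding q_def o_def using R(2)[OF inv]
    by (intro holomorphic_intros holomorphic_on_compose[of inverse _ wa, unfolded o_def]
         holomorphic_on_compose[of inverse _ wb, unfolded o_def] holomorphic_on_subset[OF hol(1)] holomorphic_on_subset[OF hol(2)]) auto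
  moreover have "(q \<circ> inverse) \<zeta> \<noteq> 0 \<and> (q \<circ> inverse) \<zeta> \<noteq> 1" if "\<zeta> \<in> ball 0 (1 / R) - {0}" for \<zeta>
    using R(2)[OF inv[OF that]] by (auto simp: q_def)
  ultimately obtain l where "((q \<circ> inverse) \<longlongrightarrow> l) (at 0) \<or> ((inverse \<circ> (q \<circ> inverse)) \<longlongrightarrow> l) (at 0)"
    using great_Picard[of "ball 0 (1/R)" 0 0 1 "q \<circ> inverse"] R(1) by auto
  hence "(q \<longlongrightarrow> l) at_infinity \<or> ((\<lambda>z. wb z / wa z) \<longlongrightarrow> l) at_infinity"
    by (simp add: lim_at_infinity_0 o_def q_def)
  moreover have "A \<noteq> 0" if "\<And>z. poly A z = wa z * vb z \<or> poly A z = wb z * va z" for A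
  proof
    assume "A = 0"
    with that nz have "eventually (\<lambda>z::complex. False) at_infinity"
      by (elim eventually_mono) (metis mult_eq_0_iff poly_0)
    thus False by (simp add: eventually_False trivial_limit_at_infinity)
  qed
  ultimately show ?thesis
  proof (elim disjE, goal_cases)
    case 1
    have "eventually (\<lambda>z. wb z \<noteq> 0) at_infinity" using nz by eventually_elim auto
    from entire_bounded_quotient[OF hol(1) hol(4) eq(2) this 1(2)[unfolded q_def]] 1(1) P
    show ?case by blast
  next
    case 2
    have "eventually (\<lambda>z. wa z \<noteq> 0) at_infinity" using nz by eventually_elim auto
    from entire_bounded_quotient[OF hol(2) hol(3) eq(1) this 2(2)] obtain B where
      "\<And>z. poly Pa z * wb z = poly B z * wa z \<and> poly B z = wb z * va z" by blast
    with 2(1)[of B] P show ?case by metis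
  qed
qed

text \<open>
  The two equations \<open>w v = P\<close> and \<open>w' (\<dots>) = P'\<close> are quadratic in \<open>f\<close>. Since \<open>w'\<close> is the
  multiple \<open>(B / A) w\<close> of \<open>w\<close>, subtracting them cancels the quadratic terms and leaves a linear
  equation for \<open>f\<close>. Denominators are cleared throughout, so that the identity holds at every point.
\<close>
lemma cofactor_linear:
  fixes A B C E P P' f w w' v a :: complex
  assumes wv: "w * v = P" and BA: "B * w = A * w'"
    and v: "v = 3 * f ^ 2 + 3 * f * w + w ^ 2 + a"
    and wv': "w' * (3 * f ^ 2 + 3 * f * w' + w' ^ 2 + a) = P'"
    and C: "C = B * P - A * P'" and E: "E = B * (A - B)"
  shows "3 * f * (A * E * P ^ 2) * v = A ^ 2 * C * v ^ 3 - (A + B) * E * P ^ 3"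
proof -
  have "C = (B * w) * v - (A * w') * (3 * f ^ 2 + 3 * f * w' + w' ^ 2 + a)"
    by (simp add: C wv[symmetric] wv'[symmetric])
  also have "\<dots> = B * w * ((w - w') * (3 * f + w + w'))"
    unfolding v BA[symmetric] by (simp add: algebra_simps power2_eq_square)
  finally have C': "C = B * w * ((w - w') * (3 * f + w + w'))" .
  have "A ^ 2 * C * v ^ 3 = B * w * (A * w - A * w') * (3 * (A * f) + A * w + A * w') * v ^ 3"
    unfolding C' by (simp add: algebra_simps power2_eq_square)
  also have "\<dots> = E * (w * v) ^ 2 * (3 * (A * f) * v + (A + B) * (w * v))"
    unfolding BA[symmetric] E by (simp add: algebra_simps power2_eq_square power3_eq_cube)
  finally show ?thesis unfolding wv by (simp add: algebra_simps power2_eq_square power3_eq_cube)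
qed

text \<open>
  Substituting the linear expression for \<open>f\<close> into the equation for \<open>v\<close> eliminates \<open>f\<close>, and \<open>w = P / v\<close>
  eliminates \<open>w\<close>. What remains is an algebraic equation for \<open>v\<close>, multiplied by \<open>3 A\<^sup>2 E\<^sup>2 P\<^sup>4 v\<^sup>2\<close> to clear
  denominators.
\<close>
lemma cofactor_sextic:
  fixes A B C E P f w v a :: complex
  assumes wv: "w * v = P" and v: "v = 3 * f ^ 2 + 3 * f * w + w ^ 2 + a"
    and key: "3 * f * (A * E * P ^ 2) * v = A ^ 2 * C * v ^ 3 - (A + B) * E * P ^ 3"
  shows "A ^ 4 * C ^ 2 * v ^ 6 + A ^ 2 * E * P ^ 3 * (C * (A - 2 * B) - 3 * E * P) * v ^ 3
    + 3 * a * (A ^ 2 * E ^ 2 * P ^ 4) * v ^ 2 + E ^ 2 * P ^ 6 * (A ^ 2 - A * B + B ^ 2) = 0" (is "?L = 0")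
proof -
  define X where "X = A ^ 2 * C * v ^ 3 - (A + B) * E * P ^ 3"
  have "?L = X ^ 2 + 3 * X * (A * E * P ^ 3) + 3 * A ^ 2 * E ^ 2 * P ^ 6
      + 3 * a * A ^ 2 * E ^ 2 * P ^ 4 * v ^ 2 - 3 * A ^ 2 * E ^ 2 * P ^ 4 * v ^ 3"
    unfolding X_def by algebra
  also have "X = 3 * f * (A * E * P ^ 2) * v" using key by (simp add: X_def)
  also have "(3 * f * (A * E * P ^ 2) * v) ^ 2 + 3 * (3 * f * (A * E * P ^ 2) * v) * (A * E * P ^ 3)
      + 3 * A ^ 2 * E ^ 2 * P ^ 6 + 3 * a * A ^ 2 * E ^ 2 * P ^ 4 * v ^ 2 - 3 * A ^ 2 * E ^ 2 * P ^ 4 * v ^ 3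
      = 3 * A ^ 2 * E ^ 2 * P ^ 4 * (3 * f ^ 2 * v ^ 2 + 3 * f * v * P + P ^ 2 + a * v ^ 2 - v * v ^ 2)"
    by algebra
  also have "3 * f ^ 2 * v ^ 2 + 3 * f * v * P + P ^ 2 + a * v ^ 2 - v * v ^ 2
      = (3 * f ^ 2 + 3 * f * w + w ^ 2 + a - v) * v ^ 2"
    unfolding wv[symmetric] by algebra
  also have "3 * f ^ 2 + 3 * f * w + w ^ 2 + a - v = 0" by (simp add: v)
  finally show ?thesis by simp
qed

text \<open>
  Each difference of two of the functions divides a nonzero polynomial; hence the differences from
  \<open>f\<close> are proportional over the rational functions, and the cofactor
  \<open>v = P1 / (f1 - f)\<close> is algebraic over them. Being entire it is rational, and \<open>f\<close> is a rational
  expression in it.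
\<close>
lemma cubics_differing_by_polys_imp_rational:
  fixes f f1 f2 :: "complex \<Rightarrow> complex"
  assumes hol: "f holomorphic_on UNIV" "f1 holomorphic_on UNIV" "f2 holomorphic_on UNIV"
    and P: "P1 \<noteq> 0" "P2 \<noteq> 0" "P3 \<noteq> 0"
    and eq: "\<And>z. (f1 z ^ 3 + a * f1 z) - (f z ^ 3 + a * f z) = poly P1 z"
            "\<And>z. (f2 z ^ 3 + a * f2 z) - (f z ^ 3 + a * f z) = poly P2 z"
            "\<And>z. (f2 z ^ 3 + a * f2 z) - (f1 z ^ 3 + a * f1 z) = poly P3 z"
  shows "\<exists>p q. q \<noteq> 0 \<and> (\<forall>z. f z * poly q z = poly p z)"
proof -
  define cof where "cof = (\<lambda>x y :: complex. x ^ 2 + x * y + y ^ 2 + a)"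
  have fac: "(x - y) * cof x y = (x ^ 3 + a * x) - (y ^ 3 + a * y)" for x y
    unfolding cof_def by algebra
  define v where "v = (\<lambda>z. cof (f1 z) (f z))"
  have v: "v holomorphic_on UNIV" unfolding v_def cof_def by (intro holomorphic_intros hol)
  have "\<exists>A B. A \<noteq> 0 \<and> B \<noteq> 0 \<and> (\<forall>z. poly B z * (f1 z - f z) = poly A z * (f2 z - f z))"
  proof (rule entire_divisors_of_polys[where va = v and vb = "\<lambda>z. cof (f2 z) (f z)" and vc = "\<lambda>z. cof (f2 z) (f1 z)"
           and Pa = P1 and Pb = P2 and Pc = P3])
    show "(\<lambda>z. cof (f2 z) (f z)) holomorphic_on UNIV"
      unfolding cof_def by (intro holomorphic_intros hol)
    show "(f2 z - f z - (f1 z - f z)) * cof (f2 z) (f1 z) = poly P3 z" for z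
      using fac[of "f2 z" "f1 z"] eq(3)[of z] by simp
  qed (use P eq v in \<open>auto simp: fac v_def intro!: holomorphic_intros hol\<close>)
  then obtain A B where AB: "A \<noteq> 0" "B \<noteq> 0" "\<And>z. poly B z * (f1 z - f z) = poly A z * (f2 z - f z)"
    by blast
  have "A \<noteq> B"
  proof
    assume "A = B"
    have "poly (B * P3) z = 0" for z
    proof -
      have "poly B z * (f2 z - f1 z) = 0" using AB(3)[of z] \<open>A = B\<close> by (auto simp: algebra_simps)
      thus ?thesis using eq(3)[of z] by auto
    qed
    hence "B * P3 = 0" using poly_all_0_iff_0 by blast
    thus False using AB P by simp
  qed
  define C where "C = B * P1 - A * P2"
  define E where "E = B * (A - B)"
  have E: "E \<noteq> 0" using AB \<open>A \<noteq> B\<close> by (simp add: E_def)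
  have key: "3 * f z * poly (A * E * P1 ^ 2) z * v z = poly (A ^ 2 * C) z * v z ^ 3 - poly ((A + B) * E * P1 ^ 3) z" for z
  proof -
    define w1 w2 where "w1 = f1 z - f z" and "w2 = f2 z - f z"
    have wv: "w1 * v z = poly P1 z" using fac[of "f1 z" "f z"] eq(1)[of z] by (simp add: w1_def v_def)
    have BA: "poly B z * w1 = poly A z * w2" using AB(3)[of z] by (simp add: w1_def w2_def)
    have v1: "v z = 3 * f z ^ 2 + 3 * f z * w1 + w1 ^ 2 + a"
      unfolding v_def cof_def w1_def by algebra
    have wv2: "w2 * (3 * f z ^ 2 + 3 * f z * w2 + w2 ^ 2 + a) = poly P2 z"
      unfolding w2_def eq(2)[of z, symmetric] by algebra
    show ?thesis
      using cofactor_linear[OF wv BA v1 wv2 refl refl] by (simp add: C_def E_def)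
  qed
  \<comment> \<open>If \<open>C = 0\<close>, the equation loses its leading term and becomes a cubic with leading coefficient
    \<open>- 3 A\<^sup>2 E\<^sup>2 P1\<^sup>4\<close>, so a nontrivial equation for \<open>v\<close> is left in both cases.\<close>
  define c6 c3 c2 c0 where
    "c6 = A ^ 4 * C ^ 2" and "c3 = A ^ 2 * E * P1 ^ 3 * (C * (A - 2 * B) - 3 * E * P1)" and
    "c2 = smult (3 * a) (A ^ 2 * E ^ 2 * P1 ^ 4)" and "c0 = E ^ 2 * P1 ^ 6 * (A ^ 2 - A * B + B ^ 2)"
  have alg: "poly c6 z * v z ^ 6 + poly c3 z * v z ^ 3 + poly c2 z * v z ^ 2 + poly c0 z = 0" for z
  proof -
    define w1 where "w1 = f1 z - f z"
    have wv: "w1 * v z = poly P1 z" using fac[of "f1 z" "f z"] eq(1)[of z] by (simp add: w1_def v_def)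
    have v1: "v z = 3 * f z ^ 2 + 3 * f z * w1 + w1 ^ 2 + a"
      unfolding v_def cof_def w1_def by algebra
    show ?thesis
      using cofactor_sextic[OF wv v1, of "poly A z" "poly E z" "poly C z" "poly B z"] key[of z]
      by (simp add: c6_def c3_def c2_def c0_def mult_ac)
  qed
  have "\<exists>N c. N > 0 \<and> c N \<noteq> 0 \<and> (\<forall>z. (\<Sum>i\<le>N. poly (c i) z * v z ^ i) = 0)"
  proof (cases "C = 0")
    case False
    thus ?thesis using AB(1) alg
      by (intro exI[of _ 6] exI[of _ "\<lambda>i. if i = 6 then c6 else if i = 3 then c3 else if i = 2 then c2 else if i = 0 then c0 else 0"])
         (simp add: eval_nat_numeral c6_def algebra_simps)
  next
    case True
    thus ?thesis using AB(1) P(1) E alg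
      by (intro exI[of _ 3] exI[of _ "\<lambda>i. if i = 3 then c3 else if i = 2 then c2 else if i = 0 then c0 else 0"])
         (simp add: eval_nat_numeral c6_def c3_def algebra_simps)
  qed
  then obtain N and c :: "nat \<Rightarrow> complex poly" where
    c: "N > 0" "c N \<noteq> 0" "\<And>z. (\<Sum>i\<le>N. poly (c i) z * v z ^ i) = 0" by blast
  obtain Y where Y: "\<And>z. poly (c N) z * v z = poly Y z"
    using entire_algebraic_imp_rational[OF v c(1) c(3)] by blast
  have "Y \<noteq> 0"
  proof
    assume "Y = 0"
    have "poly (c N * P1) z = 0" for z
      using Y[of z] \<open>Y = 0\<close> fac[of "f1 z" "f z"] eq(1)[of z] by (auto simp: v_def)
    hence "c N * P1 = 0" using poly_all_0_iff_0 by blast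
    thus False using c P by simp
  qed
  show ?thesis
  proof (intro exI conjI allI)
    show "3 * A * E * P1 ^ 2 * c N ^ 2 * Y \<noteq> 0" using AB E P c \<open>Y \<noteq> 0\<close> by simp
    show "f z * poly (3 * A * E * P1 ^ 2 * c N ^ 2 * Y) z =
        poly (A ^ 2 * C * Y ^ 3 - (A + B) * E * P1 ^ 3 * c N ^ 3) z" for z
      using key[of z] unfolding poly_mult poly_diff poly_add poly_power Y[symmetric]
      by simp algebra
  qed
qed

text \<open>
  Here \<open>G = H \<circ> f - S\<close> is the periodic part of \<open>H \<circ> f\<close>. Its poles are those of \<open>f\<close>, so the poles of
  \<open>f\<close> are invariant under the shift, and all translates of \<open>f\<close> are holomorphic on one and the same
  punctured disc around a given pole.
\<close>
lemma no_pole_if_shifts_differ_by_poly: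
  fixes f :: "complex \<Rightarrow> complex" and H S :: "complex poly"
  assumes f: "f nicely_meromorphic_on UNIV" and H: "degree H \<ge> 2" and S: "degree S > 0" and c: "c \<noteq> 0"
    and eq: "\<forall>\<^sub>\<approx>z. poly H (f (z + c)) - poly S (z + c) = poly H (f z) - poly S z"
  shows "\<not> is_pole f p"
proof
  assume pole: "is_pole f p"
  define G where "G = (\<lambda>z. poly H (f z) - poly S z)"
  have analytic: "f analytic_on {z}" if "\<not> is_pole f z" for z
    using nicely_meromorphic_on_imp_analytic_at[OF f _ that] by simp
  have Gpole: "is_pole G z" if "is_pole f z" for z
  proof -
    have "filterlim (\<lambda>z. poly H (f z)) at_infinity (at z)"
      using filterlim_compose[OF filterlim_poly_at_infinity[of H]] that H by (auto simp: is_pole_def)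
    moreover have "((\<lambda>z. - poly S z) \<longlongrightarrow> - poly S z) (at z)"
      by (intro tendsto_intros)
    ultimately have "filterlim (\<lambda>z. poly H (f z) + - poly S z) at_infinity (at z)"
      by (rule tendsto_add_filterlim_at_infinity')
    thus ?thesis by (simp add: is_pole_def G_def)
  qed
  have Gan: "G analytic_on {z}" if "f analytic_on {z}" for z
    unfolding G_def
    by (intro analytic_intros poly_analytic analytic_on_compose[OF that poly_analytic, unfolded o_def])
  have shift: "\<forall>\<^sub>\<approx>z. G (z + of_nat n * c) = G z" for n
  proof (induction n)
    case (Suc n)
    have "\<forall>\<^sub>\<approx>z. G (z + c) = G z" using eq by (simp add: G_def)
    hence "\<forall>\<^sub>\<approx>z. G (z + of_nat n * c + c) = G (z + of_nat n * c)"
      by (rule cosparse_shift)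
    with Suc show ?case by eventually_elim (simp add: algebra_simps)
  qed simp
  have shift_at: "eventually (\<lambda>z. G (z + of_nat n * c) = G z) (at z)" for n z
    using shift[of n] by (simp add: eventually_cosparse_open_eq)
  have shift_pole: "is_pole (\<lambda>z. g (z + a)) z \<longleftrightarrow> is_pole g (z + a)" for g :: "complex \<Rightarrow> complex" and a z
    using is_pole_shift_iff[of g a z] by (simp add: o_def add_ac)
  have not_pole: "\<not> is_pole G z" if "G analytic_on {z}" for z
    using that by (rule analytic_at_imp_no_pole)
  have poles: "is_pole f (z + of_nat n * c) \<longleftrightarrow> is_pole f z" for z n
  proof -
    have "is_pole f w \<longleftrightarrow> is_pole G w" for w
      using Gpole[of w] Gan[of w] not_pole[of w] analytic[of w] by blast
    moreover have "is_pole G (z + of_nat n * c) \<longleftrightarrow> is_pole G z"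
      using is_pole_cong[OF shift_at[where n = n and z = z] refl] shift_pole[of G "of_nat n * c" z] by blast
    ultimately show ?thesis by simp
  qed
  have "\<not> p islimpt {w. \<not> f analytic_on {w}}"
    using f by (intro meromorphic_on_imp_not_islimpt_singularities[of f UNIV]) (auto simp: nicely_meromorphic_on_def)
  then obtain R where R: "R > 0" "\<And>z. z \<in> ball p R - {p} \<Longrightarrow> f analytic_on {z}"
    unfolding islimpt_approachable by (auto simp: dist_commute)
  have R': "(\<lambda>z. f (z + of_nat n * c)) analytic_on {z}" if "z \<in> ball p R - {p}" for n z
  proof -
    have "\<not> is_pole f (z + of_nat n * c)"
      using analytic_at_imp_no_pole[OF R(2)[OF that]] poles[of z n] by blast
    hence "f analytic_on {z + of_nat n * c}" by (rule analytic)
    moreover have "(\<lambda>z. z + of_nat n * c) analytic_on {z}" by (intro analytic_intros)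
    ultimately show ?thesis
      using analytic_on_compose[of "\<lambda>z. z + of_nat n * c" "{z}" f] by (simp add: o_def)
  qed
  show False
  proof (rule no_pole_if_shifts_differ_by_poly_local[where f = "\<lambda>n z. f (z + of_nat n * c)" and G = G and p = p and R = R and S = S and H = H and c = c])
    show "G holomorphic_on ball p R - {p}"
      using R(2) Gan by (intro analytic_imp_holomorphic, subst analytic_on_analytic_at) blast
    show "(\<lambda>z. f (z + of_nat n * c)) holomorphic_on ball p R - {p}" for n
      using R' by (intro analytic_imp_holomorphic, subst analytic_on_analytic_at) blast
    show "is_pole (\<lambda>z. f (z + of_nat n * c)) p" for n
      using pole poles[of p n] shift_pole[of f "of_nat n * c" p] by blast
    fix n z assume z: "z \<in> ball p R - {p}"
    have shift_an: "(\<lambda>z. z + of_nat n * c) analytic_on {z}" by (intro analytic_intros)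
    have an: "(\<lambda>z. poly H (f (z + of_nat n * c)) - poly S (z + of_nat n * c) - G z) analytic_on {z}"
      by (intro analytic_on_diff Gan[OF R(2)[OF z]]
           analytic_on_compose[OF R'[OF z] poly_analytic, unfolded o_def]
           analytic_on_compose[OF shift_an poly_analytic, unfolded o_def])
    have "eventually (\<lambda>z. poly H (f (z + of_nat n * c)) - poly S (z + of_nat n * c) - G z = 0) (at z)"
      using shift_at[of n z] by eventually_elim (simp add: G_def)
    from tendsto_eventually[OF this] have
      "poly H (f (z + of_nat n * c)) - poly S (z + of_nat n * c) - G z = 0"
      using tendsto_unique[OF at_neq_bot isContD[OF analytic_at_imp_isCont[OF an]]] by blast
    thus "poly H (f (z + of_nat n * c)) = G z + poly S (z + of_nat n * c)" by (simp add: algebra_simps)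
  qed (use R(1) Gpole[OF pole] S c H in simp_all)
qed

lemma entire_eq_if_cosparse_eq:
  assumes "f holomorphic_on UNIV" "g holomorphic_on UNIV" "\<forall>\<^sub>\<approx>z::complex. f z = g z"
  shows "f z = (g z :: complex)"
proof -
  have "eventually (\<lambda>z. f z = g z) (at z)" using assms(3) by (simp add: eventually_cosparse_open_eq)
  moreover have "isCont f z" "isCont g z"
    using assms(1,2) by (auto dest!: holomorphic_on_imp_continuous_on simp: continuous_on_eq_continuous_at)
  ultimately show ?thesis
    unfolding isCont_def by (metis tendsto_cong tendsto_unique at_neq_bot)
qed

text \<open>
  The three functions \<open>f z\<close>, \<open>f (z + c)\<close> and \<open>f (z + 2 c)\<close> have cubic images that differ by nonzero
  polynomials, because a nonconstant polynomial \<open>S\<close> has no period.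
\<close>
lemma entire_cubic_shift_rational:
  fixes f :: "complex \<Rightarrow> complex" and S :: "complex poly"
  assumes f: "f holomorphic_on UNIV" and b3: "b3 \<noteq> 0" and S: "degree S > 0" and c: "c \<noteq> 0"
    and eq: "\<forall>\<^sub>\<approx>z. (b3 * f (z + c) ^ 3 + b1 * f (z + c)) - poly S (z + c) = (b3 * f z ^ 3 + b1 * f z) - poly S z"
  shows "\<exists>p q. q \<noteq> 0 \<and> (\<forall>z. f z * poly q z = poly p z)"
proof -
  define D where "D = (\<lambda>a b. smult (1 / b3) (S \<circ>\<^sub>p [:a, 1:] - S \<circ>\<^sub>p [:b, 1:]))"
  have D: "poly (D a b) z = (poly S (z + a) - poly S (z + b)) / b3" for a b z
    by (simp add: D_def poly_pcompose add_ac diff_divide_distrib)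
  have Dnz: "D a b \<noteq> 0" if "a \<noteq> b" for a b
  proof
    assume "D a b = 0"
    hence *: "poly S (z + a) = poly S (z + b)" for z using D[of a b z] b3 by simp
    have "poly S (z + (a - b)) = poly S z" for z using *[of "z - b"] by (simp add: algebra_simps)
    thus False using periodic_poly_imp_constant[of "a - b" S] that S by simp
  qed
  have hol: "(\<lambda>z. f (z + a)) holomorphic_on UNIV" for a
    by (rule holomorphic_on_compose[of "\<lambda>z. z + a" UNIV f, unfolded o_def])
       (auto intro!: holomorphic_intros holomorphic_on_subset[OF f])
  have one: "(b3 * f (z + c) ^ 3 + b1 * f (z + c)) - poly S (z + c) = (b3 * f z ^ 3 + b1 * f z) - poly S z" for z
    by (rule entire_eq_if_cosparse_eq[OF _ _ eq])
       (intro holomorphic_intros hol f holomorphic_on_compose[of "\<lambda>z. z + c" _ "poly S", unfolded o_def])+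
  have two: "(b3 * f (z + 2 * c) ^ 3 + b1 * f (z + 2 * c)) - poly S (z + 2 * c) = (b3 * f z ^ 3 + b1 * f z) - poly S z" for z
  proof -
    have "z + c + c = z + 2 * c" by simp
    with one[of "z + c"] one[of z] show ?thesis by simp
  qed
  show ?thesis
  proof (rule cubics_differing_by_polys_imp_rational[OF f hol hol Dnz Dnz Dnz])
    fix z
    have scale: "(x ^ 3 + b1 / b3 * x) - (y ^ 3 + b1 / b3 * y)
        = ((b3 * x ^ 3 + b1 * x) - (b3 * y ^ 3 + b1 * y)) / b3" for x y
      using b3 by (simp add: add_divide_distrib diff_divide_distrib)
    have swap: "p - q = r - s \<Longrightarrow> p - r = q - (s :: complex)" for p q r s
      by (simp add: algebra_simps)
    show "(f (z + c) ^ 3 + b1 / b3 * f (z + c)) - (f z ^ 3 + b1 / b3 * f z) = poly (D c 0) z"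
      using swap[OF one[of z]] unfolding D scale by simp
    show "(f (z + 2 * c) ^ 3 + b1 / b3 * f (z + 2 * c)) - (f z ^ 3 + b1 / b3 * f z) = poly (D (2 * c) 0) z"
      using swap[OF two[of z]] unfolding D scale by simp
    show "(f (z + 2 * c) ^ 3 + b1 / b3 * f (z + 2 * c)) - (f (z + c) ^ 3 + b1 / b3 * f (z + c)) = poly (D (2 * c) c) z"
      using swap[OF trans[OF two[of z] one[of z, symmetric]]] unfolding D scale by simp
  qed (use c in auto)
qed

section \<open>Periodicity\<close>

theorem theorem1p3:
  fixes f :: "complex \<Rightarrow> complex" and k :: nat and b1 b3 :: complex
  assumes "transcendental_meromorphic f"
    and "k > 0"
    and "b3 \<noteq> 0"
    and "periodic_meromorphic ((deriv ^^ k) (\<lambda>z. b3 * f z ^ 3 + b1 * f z))"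
  shows "periodic_meromorphic f"
proof -
  define H where "H = [:0, b1, 0, b3:]"
  have H: "poly H x = b3 * x ^ 3 + b1 * x" for x
    by (simp add: H_def algebra_simps power3_eq_cube)
  have degH: "degree H = 3" using assms(3) by (simp add: H_def)
  have f: "f meromorphic_on UNIV" "\<not> rational_function f"
    using assms(1) by (auto simp: transcendental_meromorphic_def)
  have F: "(\<lambda>z. poly H (f z)) meromorphic_on UNIV"
    unfolding H by (intro meromorphic_intros f)
  obtain c where c: "c \<noteq> 0"
    "\<forall>\<^sub>\<approx>z. (deriv ^^ k) (\<lambda>z. poly H (f z)) (z + c) = (deriv ^^ k) (\<lambda>z. poly H (f z)) z"
    using assms(4) by (auto simp: periodic_meromorphic_def H)
  obtain P where P: "\<forall>\<^sub>\<approx>z. poly H (f (z + c)) - poly H (f z) = poly P z"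
    using periodic_higher_deriv_imp_shift_diff_poly[OF F c(2)] by blast
  obtain S where S: "\<And>z. poly S (z + c) - poly S z = poly P z"
    using poly_eq_shift_diff[OF c(1)] by blast
  show ?thesis
  proof (cases "degree S = 0")
    case True
    then obtain s where "S = [:s:]" by (rule degree_eq_zeroE)
    hence "poly P z = 0" for z using S[of z] by simp
    hence "\<forall>\<^sub>\<approx>z. poly H (f (z + c)) = poly H (f z)" using P by simp
    from poly_value_repeats_imp_periodic[OF f(1) _ c(1) this] show ?thesis
      using f(1) degH by (simp add: periodic_meromorphic_def)
  next
    case False
    define g where "g = remove_sings f"
    have g: "g nicely_meromorphic_on UNIV"
      unfolding g_def by (rule remove_sings_nicely_meromorphic[OF f(1)])
    have gf: "\<forall>\<^sub>\<approx>z. g z = f z"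
      unfolding g_def by (rule eventually_remove_sings_eq[OF f(1)])
    have eq: "\<forall>\<^sub>\<approx>z. poly H (g (z + c)) - poly S (z + c) = poly H (g z) - poly S z"
      using P gf cosparse_shift[OF gf, of c]
    proof eventually_elim
      case (elim z)
      thus ?case using S[of z] by (simp add: algebra_simps)
    qed
    have "\<forall>z\<in>UNIV. \<not> is_pole g z"
      using no_pole_if_shifts_differ_by_poly[OF g _ _ c(1) eq] degH False by auto
    hence "g holomorphic_on UNIV"
      by (intro analytic_imp_holomorphic nicely_meromorphic_without_singularities[OF g])
    then obtain p q where pq: "q \<noteq> 0" "\<And>z. g z * poly q z = poly p z"
      using entire_cubic_shift_rational[OF _ assms(3) _ c(1), of g S b1] eq False by (auto simp: H)
    have "\<forall>\<^sub>\<approx>z. poly q z \<noteq> 0"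
      using eventually_not_in_cosparse[OF finite_imp_sparse[OF poly_roots_finite[OF pq(1)]]] by simp
    with gf have "\<forall>\<^sub>\<approx>z. f z = poly p z / poly q z"
    proof eventually_elim
      case (elim z)
      thus ?case using pq(2)[of z] by (simp add: field_simps)
    qed
    hence "rational_function f" using pq(1) by (auto simp: rational_function_def)
    thus ?thesis using f(2) by contradiction
  qed
qed

end
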